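(* Let $\lambda>1$ and let $f_\lambda:\mathbb{R}_+\to\mathbb{R}_+$ be the dilation $f_\lambda(x)=\lambda x$. Then the group $C^{*}([f_\lambda])$ is isomorphic to $\mathbb{R}_+$, the multiplicative group of positive real numbers: $$C^{*}([f_\lambda])\cong \mathbb{R}_{+}.$$
   Context: $\mathbb{R}_+=(0,\infty)$ with the Euclidean metric. A map $f:\mathbb{R}_+\to\mathbb{R}_+$ (not necessarily continuous) is a quasi-isometry if there are $\mu\ge1,\delta\ge0,M>0$ with $\frac1\mu|x-y|-\delta\le|f(x)-f(y)|\le\mu|x-y|+\delta$ for all $x,y$, and every point of $\mathbb{R}_+$ is within distance $M$ of $f(\mathbb{R}_+)$. Two quasi-isometries are equivalent, $f\sim g$, if $\sup_x|f(x)-g(x)|<\infty$; the equivalence classes $[f]$ form a group $QI(\mathbb{R}_+)$ under composition. For a quasi-isometry $g$, $g^{-1}$ denotes a quasi-inverse: a quasi-isometry such that $|g^{-1}(g(x))-x|$ and $|g(g^{-1}(x))-x|$ are bounded uniformly in $x$ (unique up to bounded distance). A sequence $\{x_n\}\subset\mathbb{R}_+$ with $x_n\to\infty$ is coarsely dense at infinity if there are $D>0,T_0>0$ such that for every $t\ge T_0$ there is an index $n$ with $|x_n-t|\le D$. For $[g]\in QI(\mathbb{R}_+)$ put $$I[g]=\Big\{\lim_{n\to\infty}\tfrac{x_n}{g^{-1}(x_n)} : \{x_n\}\text{ is coarsely dense at infinity and the limit exists}\Big\};$$ this set depends only on the class $[g]$. The centralizer is $C([f_\lambda])=\{[g]\in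 QI(\mathbb{R}_+):[g][f_\lambda]=[f_\lambda][g]\}$, and $C^{*}([f_\lambda])=\{[g]\in C([f_\lambda]): I[g]\ne\varnothing\}$, which is a subgroup of $C([f_\lambda])$. *)

theory Defs
  imports Complex_Main "HOL-Algebra.Group"
begin

section \<open>Quasi-isometries of the open half-line\<close>

text \<open>
  A self-map of the half-line \<open>{0<..}\<close> is represented by a function on \<^typ>\<open>real\<close> that
  maps \<open>{0<..}\<close> into itself.  Its values elsewhere are irrelevant: no definition
  below refers to them, and two functions agreeing on \<open>{0<..}\<close> are equivalent, so passing to
  equivalence classes gives exactly the classes of self-maps of the half-line.
\<close>

definition quasi_isometry :: "(real \<Rightarrow> real) \<Rightarrow> bool"
  where "quasi_isometry f \<longleftrightarrow> f \<in> {0<..} \<rightarrow> {0<..} \<and>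
    (\<exists>\<mu> \<delta> M. \<mu> \<ge> 1 \<and> \<delta> \<ge> 0 \<and> M > 0 \<and>
      (\<forall>x\<in>{0<..}. \<forall>y\<in>{0<..}.
         1 / \<mu> * \<bar>x - y\<bar> - \<delta> \<le> \<bar>f x - f y\<bar> \<and> \<bar>f x - f y\<bar> \<le> \<mu> * \<bar>x - y\<bar> + \<delta>) \<and>
      (\<forall>y\<in>{0<..}. \<exists>x\<in>{0<..}. \<bar>f x - y\<bar> \<le> M))"

definition bounded_distance :: "(real \<Rightarrow> real) \<Rightarrow> (real \<Rightarrow> real) \<Rightarrow> bool"
  where "bounded_distance f g \<longleftrightarrow> bdd_above ((\<lambda>x. \<bar>f x - g x\<bar>) ` {0<..})"

definition qi_rel :: "((real \<Rightarrow> real) \<times> (real \<Rightarrow> real)) set"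
  where "qi_rel = {(f, g). quasi_isometry f \<and> quasi_isometry g \<and> bounded_distance f g}"

definition qi_class :: "(real \<Rightarrow> real) \<Rightarrow> (real \<Rightarrow> real) set"
  where "qi_class f = qi_rel `` {f}"

definition QI :: "(real \<Rightarrow> real) set monoid"
  where "QI = \<lparr>carrier = {f. quasi_isometry f} // qi_rel,
               mult = (\<lambda>p q. \<Union>f\<in>p. \<Union>g\<in>q. qi_class (f \<circ> g)),
               one = qi_class id\<rparr>"

definition quasi_inverse :: "(real \<Rightarrow> real) \<Rightarrow> (real \<Rightarrow> real) \<Rightarrow> bool"
  where "quasi_inverse g h \<longleftrightarrow>
    quasi_isometry h \<and> bounded_distance (h \<circ> g) id \<and> bounded_distance (g \<circ> h) id"

definition coarsely_dense_at_infinity :: "(nat \<Rightarrow> real) \<Rightarrow> bool"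
  where "coarsely_dense_at_infinity x \<longleftrightarrow>
    (\<forall>n. x n \<in> {0<..}) \<and> filterlim x at_top sequentially \<and>
    (\<exists>D>0. \<exists>T\<^sub>0>0. \<forall>t\<ge>T\<^sub>0. \<exists>n. \<bar>x n - t\<bar> \<le> D)"

text \<open>
  The limit set of a class; it does not depend on the representative \<open>g\<close> or on its
  quasi-inverse \<open>h\<close>, see \<open>limit_set_representative\<close> below.
\<close>

definition limit_set :: "(real \<Rightarrow> real) set \<Rightarrow> real set"
  where "limit_set q = {L. \<exists>g\<in>q. \<exists>h x. quasi_inverse g h \<and> coarsely_dense_at_infinity x \<and>
                             (\<lambda>n. x n / h (x n)) \<longlonglongrightarrow> L}"

definition dilation :: "real \<Rightarrow> real \<Rightarrow> real"
  where "dilation lam x = lam * x"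

definition dilation_centralizer :: "real \<Rightarrow> (real \<Rightarrow> real) set set"
  where "dilation_centralizer lam =
    {q \<in> carrier QI. q \<otimes>\<^bsub>QI\<^esub> qi_class (dilation lam) = qi_class (dilation lam) \<otimes>\<^bsub>QI\<^esub> q}"

definition Cstar :: "real \<Rightarrow> (real \<Rightarrow> real) set set"
  where "Cstar lam = {q \<in> dilation_centralizer lam. limit_set q \<noteq> {}}"

definition Cstar_group :: "real \<Rightarrow> (real \<Rightarrow> real) set monoid"
  where "Cstar_group lam = QI\<lparr>carrier := Cstar lam\<rparr>"

definition pos_real_group :: "real monoid"
  where "pos_real_group = \<lparr>carrier = {0<..}, mult = (*), one = 1\<rparr>"

section \<open>The group of quasi-isometries\<close>

lemma bounded_distance_iff: "bounded_distance f g \<longleftrightarrow> (\<exists>K\<ge>0. \<forall>x>0. \<bar>f x - g x\<bar> \<le> K)"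
proof
  assume "bounded_distance f g"
  then obtain K where K: "\<bar>f x - g x\<bar> \<le> K" if "x > 0" for x
    unfolding bounded_distance_def bdd_above_def by auto
  moreover have "K \<ge> 0" using K[of 1] by linarith
  ultimately show "\<exists>K\<ge>0. \<forall>x>0. \<bar>f x - g x\<bar> \<le> K" by blast
next
  assume "\<exists>K\<ge>0. \<forall>x>0. \<bar>f x - g x\<bar> \<le> K"
  then show "bounded_distance f g"
    unfolding bounded_distance_def bdd_above_def by auto
qed

lemma bounded_distance_refl: "bounded_distance f f"
  unfolding bounded_distance_iff by auto

lemma bounded_distance_sym: "bounded_distance f g \<Longrightarrow> bounded_distance g f"
  unfolding bounded_distance_iff by (auto simp: abs_minus_commute)

lemma bounded_distance_trans:
  assumes "bounded_distance f g" "bounded_distance g h"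
  shows "bounded_distance f h"
proof -
  obtain K L where "K \<ge> 0" "\<forall>x>0. \<bar>f x - g x\<bar> \<le> K" "L \<ge> 0" "\<forall>x>0. \<bar>g x - h x\<bar> \<le> L"
    using assms unfolding bounded_distance_iff by blast
  then have "K + L \<ge> 0" "\<forall>x>0. \<bar>f x - h x\<bar> \<le> K + L" by (fastforce, smt (verit))
  then show ?thesis unfolding bounded_distance_iff by blast
qed

lemma quasi_isometryE:
  assumes "quasi_isometry f"
  obtains \<mu> \<delta> M where "\<mu> \<ge> 1" "\<delta> \<ge> 0" "M > 0" "\<And>x. x > 0 \<Longrightarrow> f x > 0"
    "\<And>x y. x > 0 \<Longrightarrow> y > 0 \<Longrightarrow> \<bar>x - y\<bar> \<le> \<mu> * \<bar>f x - f y\<bar> + \<mu> * \<delta>"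
    "\<And>x y. x > 0 \<Longrightarrow> y > 0 \<Longrightarrow> \<bar>f x - f y\<bar> \<le> \<mu> * \<bar>x - y\<bar> + \<delta>"
    "\<And>y. y > 0 \<Longrightarrow> \<exists>x>0. \<bar>f x - y\<bar> \<le> M"
proof -
  obtain \<mu> \<delta> M where *: "\<mu> \<ge> 1" "\<delta> \<ge> 0" "M > 0" "\<forall>x>0. f x > 0"
    "\<forall>x>0. \<forall>y>0. 1 / \<mu> * \<bar>x - y\<bar> - \<delta> \<le> \<bar>f x - f y\<bar> \<and> \<bar>f x - f y\<bar> \<le> \<mu> * \<bar>x - y\<bar> + \<delta>"
    "\<forall>y>0. \<exists>x>0. \<bar>f x - y\<bar> \<le> M"
    using assms unfolding quasi_isometry_def Pi_iff Ball_def Bex_def greaterThan_iff by blast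
  have "\<bar>x - y\<bar> \<le> \<mu> * \<bar>f x - f y\<bar> + \<mu> * \<delta>" if "x > 0" "y > 0" for x y
  proof -
    have "\<bar>x - y\<bar> / \<mu> \<le> \<bar>f x - f y\<bar> + \<delta>" using *(5) that by fastforce
    then have "\<bar>x - y\<bar> \<le> (\<bar>f x - f y\<bar> + \<delta>) * \<mu>" using *(1) by (simp add: pos_divide_le_eq)
    then show ?thesis by (simp add: algebra_simps)
  qed
  with * show thesis using that[of \<mu> \<delta> M] by simp
qed

lemma quasi_isometryI:
  assumes "\<mu> \<ge> 1" "\<delta> \<ge> 0" "\<And>x. x > 0 \<Longrightarrow> f x > 0"
    "\<And>x y. x > 0 \<Longrightarrow> y > 0 \<Longrightarrow> \<bar>x - y\<bar> \<le> \<mu> * \<bar>f x - f y\<bar> + \<delta>"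
    "\<And>x y. x > 0 \<Longrightarrow> y > 0 \<Longrightarrow> \<bar>f x - f y\<bar> \<le> \<mu> * \<bar>x - y\<bar> + \<delta>"
    "\<And>y. y > 0 \<Longrightarrow> \<exists>x>0. \<bar>f x - y\<bar> \<le> M"
  shows "quasi_isometry f"
proof -
  have "1 / \<mu> * \<bar>x - y\<bar> - \<delta> \<le> \<bar>f x - f y\<bar>" if "x > 0" "y > 0" for x y
  proof -
    have "\<delta> \<le> \<mu> * \<delta>" using assms(1,2) by (simp add: mult_le_cancel_right1)
    then have "\<bar>x - y\<bar> \<le> (\<bar>f x - f y\<bar> + \<delta>) * \<mu>"
      using assms(4)[OF that] by (simp add: algebra_simps)
    then have "\<bar>x - y\<bar> / \<mu> \<le> \<bar>f x - f y\<bar> + \<delta>" using assms(1) by (simp add: pos_divide_le_eq)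
    then show ?thesis by simp
  qed
  moreover have "\<forall>y>0. \<exists>x>0. \<bar>f x - y\<bar> \<le> max M 1" using assms(6) by fastforce
  moreover have "max M 1 > 0" by simp
  ultimately show ?thesis
    unfolding quasi_isometry_def using assms(1,2,3,5)
    by (intro conjI exI[of _ \<mu>] exI[of _ \<delta>] exI[of _ "max M 1"]) auto
qed

lemma quasi_isometry_dilation:
  assumes "c > 0"
  shows "quasi_isometry (dilation c)"
proof (rule quasi_isometryI[where \<mu> = "max c (1 / c)" and \<delta> = 0 and M = 0])
  show "max c (1 / c) \<ge> 1" using assms by (cases "c \<ge> 1") (auto simp: le_max_iff_disj)
  fix x y :: real
  have eq: "\<bar>c * x - c * y\<bar> = c * \<bar>x - y\<bar>"
    using assms by (simp add: abs_mult flip: right_diff_distrib)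
  have "\<bar>x - y\<bar> = 1 / c * (c * \<bar>x - y\<bar>)" using assms by simp
  also have "\<dots> \<le> max c (1 / c) * (c * \<bar>x - y\<bar>)" using assms by (intro mult_right_mono) auto
  finally show "\<bar>x - y\<bar> \<le> max c (1 / c) * \<bar>dilation c x - dilation c y\<bar> + 0"
    by (simp add: dilation_def eq)
  show "\<bar>dilation c x - dilation c y\<bar> \<le> max c (1 / c) * \<bar>x - y\<bar> + 0"
    unfolding dilation_def eq by (simp add: mult_right_mono)
next
  fix y :: real assume "y > 0"
  then show "\<exists>x>0. \<bar>dilation c x - y\<bar> \<le> 0"
    using assms by (intro exI[of _ "y / c"]) (simp add: dilation_def)
qed (use assms in \<open>auto simp: dilation_def\<close>)

lemma dilation_1: "dilation 1 = id"
  by (auto simp: dilation_def)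

lemma quasi_isometry_id: "quasi_isometry id"
  using quasi_isometry_dilation[of 1] by (simp add: dilation_1)

lemma quasi_isometry_comp:
  assumes "quasi_isometry f" "quasi_isometry g"
  shows "quasi_isometry (f \<circ> g)"
proof -
  obtain \<mu> \<delta> M where f: "\<mu> \<ge> 1" "\<delta> \<ge> 0" "M > 0" "\<And>x. x > 0 \<Longrightarrow> f x > 0"
    "\<And>x y. x > 0 \<Longrightarrow> y > 0 \<Longrightarrow> \<bar>x - y\<bar> \<le> \<mu> * \<bar>f x - f y\<bar> + \<mu> * \<delta>"
    "\<And>x y. x > 0 \<Longrightarrow> y > 0 \<Longrightarrow> \<bar>f x - f y\<bar> \<le> \<mu> * \<bar>x - y\<bar> + \<delta>"
    "\<And>y. y > 0 \<Longrightarrow> \<exists>x>0. \<bar>f x - y\<bar> \<le> M"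
    using quasi_isometryE[OF assms(1)] by metis
  obtain \<nu> \<epsilon> N where g: "\<nu> \<ge> 1" "\<epsilon> \<ge> 0" "N > 0" "\<And>x. x > 0 \<Longrightarrow> g x > 0"
    "\<And>x y. x > 0 \<Longrightarrow> y > 0 \<Longrightarrow> \<bar>x - y\<bar> \<le> \<nu> * \<bar>g x - g y\<bar> + \<nu> * \<epsilon>"
    "\<And>x y. x > 0 \<Longrightarrow> y > 0 \<Longrightarrow> \<bar>g x - g y\<bar> \<le> \<nu> * \<bar>x - y\<bar> + \<epsilon>"
    "\<And>y. y > 0 \<Longrightarrow> \<exists>x>0. \<bar>g x - y\<bar> \<le> N"
    using quasi_isometryE[OF assms(2)] by metis
  define d where "d = \<nu> * \<mu> * \<delta> + \<nu> * \<epsilon> + \<mu> * \<epsilon> + \<delta>"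
  have pos: "\<nu> * \<mu> * \<delta> \<ge> 0" "\<nu> * \<epsilon> \<ge> 0" "\<mu> * \<epsilon> \<ge> 0" using f g by simp_all
  show ?thesis
  proof (rule quasi_isometryI[where \<mu> = "\<nu> * \<mu>" and \<delta> = d and M = "\<mu> * N + \<delta> + M"])
    show "\<nu> * \<mu> \<ge> 1" using f(1) g(1) mult_mono[of 1 \<nu> 1 \<mu>] by simp
    show "d \<ge> 0" using pos f(2) by (simp add: d_def)
    show "(f \<circ> g) x > 0" if "x > 0" for x using that f(4) g(4) by simp
    fix x y :: real assume xy: "x > 0" "y > 0"
    have "\<nu> * \<bar>g x - g y\<bar> \<le> \<nu> * (\<mu> * \<bar>f (g x) - f (g y)\<bar> + \<mu> * \<delta>)"
      using g(1) f(5)[OF g(4)[OF xy(1)] g(4)[OF xy(2)]] by (intro mult_left_mono) auto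
    then show "\<bar>x - y\<bar> \<le> \<nu> * \<mu> * \<bar>(f \<circ> g) x - (f \<circ> g) y\<bar> + d"
      using g(5)[OF xy] pos f(2) by (simp add: d_def algebra_simps)
    have "\<mu> * \<bar>g x - g y\<bar> \<le> \<mu> * (\<nu> * \<bar>x - y\<bar> + \<epsilon>)"
      using f(1) g(6)[OF xy] by (intro mult_left_mono) auto
    then show "\<bar>(f \<circ> g) x - (f \<circ> g) y\<bar> \<le> \<nu> * \<mu> * \<bar>x - y\<bar> + d"
      using f(6)[OF g(4)[OF xy(1)] g(4)[OF xy(2)]] pos by (simp add: d_def algebra_simps)
  next
    fix z :: real assume "z > 0"
    then obtain y where y: "y > 0" "\<bar>f y - z\<bar> \<le> M" using f(7) by blast
    then obtain x where x: "x > 0" "\<bar>g x - y\<bar> \<le> N" using g(7) by blast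
    have "\<mu> * \<bar>g x - y\<bar> \<le> \<mu> * N" using x(2) f(1) by (intro mult_left_mono) auto
    then have "\<bar>(f \<circ> g) x - z\<bar> \<le> \<mu> * N + \<delta> + M"
      using f(6)[OF g(4)[OF x(1)] y(1)] y(2) by simp
    with x(1) show "\<exists>x>0. \<bar>(f \<circ> g) x - z\<bar> \<le> \<mu> * N + \<delta> + M" by blast
  qed
qed

lemma bounded_distance_comp:
  assumes "quasi_isometry f" "quasi_isometry g" "quasi_isometry g'"
    and "bounded_distance f f'" "bounded_distance g g'"
  shows "bounded_distance (f \<circ> g) (f' \<circ> g')"
proof -
  obtain \<mu> \<delta> M where f: "\<mu> \<ge> 1" "\<delta> \<ge> 0"
    "\<And>x y. x > 0 \<Longrightarrow> y > 0 \<Longrightarrow> \<bar>f x - f y\<bar> \<le> \<mu> * \<bar>x - y\<bar> + \<delta>"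
    using quasi_isometryE[OF assms(1)] by metis
  have g: "\<And>x. x > 0 \<Longrightarrow> g x > 0" "\<And>x. x > 0 \<Longrightarrow> g' x > 0"
    using quasi_isometryE assms(2,3) by metis+
  obtain K where K: "K \<ge> 0" "\<forall>x>0. \<bar>f x - f' x\<bar> \<le> K"
    using assms(4) unfolding bounded_distance_iff by blast
  obtain L where L: "L \<ge> 0" "\<forall>x>0. \<bar>g x - g' x\<bar> \<le> L"
    using assms(5) unfolding bounded_distance_iff by blast
  have "\<bar>f (g x) - f' (g' x)\<bar> \<le> \<mu> * L + \<delta> + K" if "x > 0" for x
  proof -
    have "\<mu> * \<bar>g x - g' x\<bar> \<le> \<mu> * L" using L that f(1) by (intro mult_left_mono) auto
    moreover have "\<bar>f (g' x) - f' (g' x)\<bar> \<le> K" using K g that by blast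
    ultimately show ?thesis using f(3)[OF g(1)[OF that] g(2)[OF that]] by linarith
  qed
  moreover have "\<mu> * L + \<delta> + K \<ge> 0" using f K L by simp
  ultimately show ?thesis unfolding bounded_distance_iff comp_def by blast
qed

lemma quasi_inverse_exists:
  assumes "quasi_isometry f"
  shows "\<exists>h. quasi_inverse f h"
proof -
  obtain \<mu> \<delta> M where f: "\<mu> \<ge> 1" "\<delta> \<ge> 0" "M > 0" "\<And>x. x > 0 \<Longrightarrow> f x > 0"
    "\<And>x y. x > 0 \<Longrightarrow> y > 0 \<Longrightarrow> \<bar>x - y\<bar> \<le> \<mu> * \<bar>f x - f y\<bar> + \<mu> * \<delta>"
    "\<And>x y. x > 0 \<Longrightarrow> y > 0 \<Longrightarrow> \<bar>f x - f y\<bar> \<le> \<mu> * \<bar>x - y\<bar> + \<delta>"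
    "\<And>y. y > 0 \<Longrightarrow> \<exists>x>0. \<bar>f x - y\<bar> \<le> M"
    using quasi_isometryE[OF assms] by metis
  obtain h where h: "\<And>y. y > 0 \<Longrightarrow> h y > 0" "\<And>y. y > 0 \<Longrightarrow> \<bar>f (h y) - y\<bar> \<le> M"
    using f(7) by metis
  have hf: "\<bar>h (f x) - x\<bar> \<le> \<mu> * M + \<mu> * \<delta>" if "x > 0" for x
  proof -
    have "\<mu> * \<bar>f (h (f x)) - f x\<bar> \<le> \<mu> * M"
      using h(2)[OF f(4)[OF that]] f(1) by (intro mult_left_mono) auto
    then show ?thesis using f(5)[OF h(1)[OF f(4)[OF that]] that] by linarith
  qed
  have pos: "\<mu> * M \<ge> 0" "\<mu> * \<delta> \<ge> 0" using f by simp_all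
  have "quasi_isometry h"
  proof (rule quasi_isometryI[where \<mu> = \<mu> and \<delta> = "2 * (\<mu> * M) + \<mu> * \<delta> + 2 * M + \<delta>"
            and M = "\<mu> * M + \<mu> * \<delta>"])
    show "2 * (\<mu> * M) + \<mu> * \<delta> + 2 * M + \<delta> \<ge> 0" using pos f by simp
    fix x y :: real assume xy: "x > 0" "y > 0"
    show "\<bar>x - y\<bar> \<le> \<mu> * \<bar>h x - h y\<bar> + (2 * (\<mu> * M) + \<mu> * \<delta> + 2 * M + \<delta>)"
      using f(6)[OF h(1)[OF xy(1)] h(1)[OF xy(2)]] h(2)[OF xy(1)] h(2)[OF xy(2)] pos by linarith
    have "\<bar>f (h x) - f (h y)\<bar> \<le> \<bar>x - y\<bar> + 2 * M"
      using h(2)[OF xy(1)] h(2)[OF xy(2)] by linarith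
    then have "\<mu> * \<bar>f (h x) - f (h y)\<bar> \<le> \<mu> * (\<bar>x - y\<bar> + 2 * M)"
      using f(1) by (intro mult_left_mono) auto
    then show "\<bar>h x - h y\<bar> \<le> \<mu> * \<bar>x - y\<bar> + (2 * (\<mu> * M) + \<mu> * \<delta> + 2 * M + \<delta>)"
      using f(5)[OF h(1)[OF xy(1)] h(1)[OF xy(2)]] f(2,3) by (simp add: algebra_simps)
  next
    fix y :: real assume "y > 0"
    then show "\<exists>x>0. \<bar>h x - y\<bar> \<le> \<mu> * M + \<mu> * \<delta>" using hf f(4) by blast
  qed (use f h in auto)
  moreover have "bounded_distance (h \<circ> f) id"
    unfolding bounded_distance_iff using hf pos by (intro exI[of _ "\<mu> * M + \<mu> * \<delta>"]) auto
  moreover have "bounded_distance (f \<circ> h) id"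
    unfolding bounded_distance_iff using h f(3) by (intro exI[of _ M]) auto
  ultimately show ?thesis unfolding quasi_inverse_def by blast
qed

lemma quasi_inverse_sym: "quasi_isometry g \<Longrightarrow> quasi_inverse g h \<Longrightarrow> quasi_inverse h g"
  by (simp add: quasi_inverse_def)

lemma quasi_inverse_unique:
  assumes "quasi_isometry g" "quasi_isometry g'" "bounded_distance g g'"
    "quasi_inverse g h" "quasi_inverse g' h'"
  shows "bounded_distance h h'"
proof -
  have h: "quasi_isometry h" "quasi_isometry h'"
    "bounded_distance (h \<circ> g) id" "bounded_distance (g' \<circ> h') id"
    using assms(4,5) by (auto simp: quasi_inverse_def)
  have "bounded_distance h (h \<circ> (g' \<circ> h'))"
    using bounded_distance_comp[OF h(1) quasi_isometry_comp[OF assms(2) h(2)] quasi_isometry_id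
        bounded_distance_refl h(4)]
    by (simp add: bounded_distance_sym)
  moreover have "bounded_distance (h \<circ> (g' \<circ> h')) (h \<circ> (g \<circ> h'))"
    by (intro bounded_distance_comp bounded_distance_refl bounded_distance_sym[OF assms(3)]
        quasi_isometry_comp h assms)
  moreover have "bounded_distance ((h \<circ> g) \<circ> h') (id \<circ> h')"
    by (intro bounded_distance_comp bounded_distance_refl quasi_isometry_comp h assms)
  ultimately show ?thesis by (metis bounded_distance_trans comp_assoc id_comp)
qed

lemma quasi_inverse_comp:
  assumes "quasi_isometry g" "quasi_isometry g'" "quasi_inverse g h" "quasi_inverse g' h'"
  shows "quasi_inverse (g \<circ> g') (h' \<circ> h)"
proof -
  have *: "bounded_distance (a \<circ> (b \<circ> c) \<circ> d) id"
    if "quasi_isometry a" "quasi_isometry b" "quasi_isometry c" "quasi_isometry d"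
      "bounded_distance (b \<circ> c) id" "bounded_distance (a \<circ> d) id" for a b c d :: "real \<Rightarrow> real"
  proof -
    have "bounded_distance ((a \<circ> (b \<circ> c)) \<circ> d) ((a \<circ> id) \<circ> d)"
      by (intro bounded_distance_comp bounded_distance_refl quasi_isometry_comp that)
        (rule quasi_isometry_id)
    then show ?thesis using that(6) bounded_distance_trans by force
  qed
  show ?thesis
    using *[of h' h g g'] *[of g g' h' h] assms
    by (simp add: quasi_inverse_def quasi_isometry_comp comp_assoc)
qed

lemma equiv_qi_rel: "equiv {f. quasi_isometry f} qi_rel"
proof (rule equivI)
  show "refl_on {f. quasi_isometry f} qi_rel"
    by (auto simp: refl_on_def qi_rel_def bounded_distance_refl)
  show "qi_rel \<subseteq> {f. quasi_isometry f} \<times> {f. quasi_isometry f}"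
    by (auto simp: qi_rel_def)
  show "sym qi_rel" by (auto simp: sym_def qi_rel_def bounded_distance_sym)
  show "trans qi_rel"
    unfolding trans_def qi_rel_def using bounded_distance_trans by blast
qed

lemma qi_class_eq_iff:
  "quasi_isometry f \<Longrightarrow> quasi_isometry g \<Longrightarrow> qi_class f = qi_class g \<longleftrightarrow> bounded_distance f g"
  unfolding qi_class_def by (subst eq_equiv_class_iff[OF equiv_qi_rel]) (auto simp: qi_rel_def)

lemma carrier_QI: "carrier QI = qi_class ` {f. quasi_isometry f}"
  unfolding QI_def quotient_def qi_class_def by auto

lemma one_QI: "\<one>\<^bsub>QI\<^esub> = qi_class id"
  by (simp add: QI_def)

lemma mult_QI:
  assumes "quasi_isometry f" "quasi_isometry g"
  shows "qi_class f \<otimes>\<^bsub>QI\<^esub> qi_class g = qi_class (f \<circ> g)"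
proof -
  have "congruent2 qi_rel qi_rel (\<lambda>f g. qi_class (f \<circ> g))"
    unfolding congruent2_def
    by (auto simp: qi_rel_def qi_class_eq_iff quasi_isometry_comp bounded_distance_comp)
  from UN_equiv_class2[OF equiv_qi_rel equiv_qi_rel this] assms
  show ?thesis by (simp add: QI_def qi_class_def)
qed

lemma group_QI: "group QI"
proof (rule groupI)
  show "\<one>\<^bsub>QI\<^esub> \<in> carrier QI" by (simp add: one_QI carrier_QI quasi_isometry_id)
next
  fix x assume "x \<in> carrier QI"
  then obtain f where f: "quasi_isometry f" "x = qi_class f" by (auto simp: carrier_QI)
  then obtain h where h: "quasi_inverse f h" using quasi_inverse_exists by blast
  then have "qi_class h \<otimes>\<^bsub>QI\<^esub> x = \<one>\<^bsub>QI\<^esub>"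
    using f
    by (simp add: mult_QI one_QI quasi_inverse_def qi_class_eq_iff quasi_isometry_comp
        quasi_isometry_id)
  moreover have "qi_class h \<in> carrier QI" using h by (simp add: carrier_QI quasi_inverse_def)
  ultimately show "\<exists>y\<in>carrier QI. y \<otimes>\<^bsub>QI\<^esub> x = \<one>\<^bsub>QI\<^esub>" by blast
qed (auto simp: carrier_QI one_QI mult_QI quasi_isometry_comp quasi_isometry_id comp_assoc)

lemma inv_QI:
  assumes "quasi_isometry g" "quasi_inverse g h"
  shows "inv\<^bsub>QI\<^esub> qi_class g = qi_class h"
proof -
  have h: "quasi_isometry h" "bounded_distance (h \<circ> g) id"
    using assms(2) by (auto simp: quasi_inverse_def)
  show ?thesis
  proof (rule group.inv_equality[OF group_QI])
    show "qi_class h \<otimes>\<^bsub>QI\<^esub> qi_class g = \<one>\<^bsub>QI\<^esub>"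
      using h assms(1)
      by (simp add: mult_QI one_QI qi_class_eq_iff quasi_isometry_comp quasi_isometry_id)
  qed (use h assms in \<open>auto simp: carrier_QI\<close>)
qed

section \<open>The limit set\<close>

lemma quasi_isometry_at_top:
  assumes "quasi_isometry h"
  shows "filterlim h at_top at_top"
  unfolding filterlim_at_top
proof
  fix Z :: real
  obtain \<mu> \<delta> M where h: "\<mu> \<ge> 1" "\<And>x. x > 0 \<Longrightarrow> h x > 0"
    "\<And>x y. x > 0 \<Longrightarrow> y > 0 \<Longrightarrow> \<bar>x - y\<bar> \<le> \<mu> * \<bar>h x - h y\<bar> + \<mu> * \<delta>"
    using quasi_isometryE[OF assms] by metis
  define W where "W = \<bar>Z\<bar> + h 1"
  show "\<forall>\<^sub>F x in at_top. Z \<le> h x"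
  proof (rule eventually_at_top_linorderI[of "2 + \<mu> * W + \<mu> * \<bar>\<delta>\<bar>"])
    fix x assume x: "2 + \<mu> * W + \<mu> * \<bar>\<delta>\<bar> \<le> x"
    have nn: "\<mu> * W \<ge> 0" "\<mu> * \<bar>\<delta>\<bar> \<ge> 0" "\<mu> * \<delta> \<le> \<mu> * \<bar>\<delta>\<bar>"
      using h(1) h(2)[of 1] by (auto simp: W_def intro: mult_left_mono)
    then have "\<mu> * W < \<mu> * \<bar>h x - h 1\<bar>" using h(3)[of x 1] x by linarith
    then have "W < \<bar>h x - h 1\<bar>" using h(1) by simp
    moreover have "h x > 0" using h(2) x nn by simp
    ultimately show "Z \<le> h x" using h(2)[of 1] unfolding W_def by linarith
  qed
qed

lemma bounded_over_at_top:
  fixes a h :: "real \<Rightarrow> real"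
  assumes "filterlim h at_top at_top" "\<forall>\<^sub>F t in at_top. \<bar>a t\<bar> \<le> K"
  shows "((\<lambda>t. a t / h t) \<longlongrightarrow> 0) at_top"
proof (rule tendsto_0_le[where K = 1])
  show "\<forall>\<^sub>F t in at_top. norm (a t / h t) \<le> norm (K / h t) * 1"
    using assms(2) filterlim_at_top_dense[THEN iffD1, OF assms(1), rule_format, of 0]
    by eventually_elim (auto simp: divide_right_mono)
  show "((\<lambda>t. K / h t) \<longlongrightarrow> 0) at_top"
    by (rule real_tendsto_divide_at_top[OF tendsto_const assms(1)])
qed

lemma ratio_tendsto_at_top:
  assumes h: "quasi_isometry h" and x: "coarsely_dense_at_infinity x"
    and lim: "(\<lambda>n. x n / h (x n)) \<longlonglongrightarrow> L"
  shows "((\<lambda>t. t / h t) \<longlongrightarrow> L) at_top"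
proof -
  obtain \<mu> \<delta> M where q: "\<mu> \<ge> 1" "\<And>x. x > 0 \<Longrightarrow> h x > 0"
    "\<And>x y. x > 0 \<Longrightarrow> y > 0 \<Longrightarrow> \<bar>h x - h y\<bar> \<le> \<mu> * \<bar>x - y\<bar> + \<delta>"
    using quasi_isometryE[OF h] by metis
  have xpos: "x n > 0" for n using x by (simp add: coarsely_dense_at_infinity_def)
  obtain D T\<^sub>0 where "D > 0" "\<forall>t\<ge>T\<^sub>0. \<exists>n. \<bar>x n - t\<bar> \<le> D"
    using x unfolding coarsely_dense_at_infinity_def by blast
  then obtain k where k: "\<And>t. t \<ge> T\<^sub>0 \<Longrightarrow> \<bar>x (k t) - t\<bar> \<le> D" by metis
  have "filterlim k sequentially at_top"
    unfolding filterlim_at_top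
  proof
    fix N :: nat
    define B where "B = (\<Sum>i<N. x i)"
    show "\<forall>\<^sub>F t in at_top. N \<le> k t"
    proof (rule eventually_at_top_linorderI[of "max T\<^sub>0 (B + D + 1)"])
      fix t assume t: "max T\<^sub>0 (B + D + 1) \<le> t"
      show "N \<le> k t"
      proof (rule ccontr)
        assume "\<not> N \<le> k t"
        then have "x (k t) \<le> B"
          unfolding B_def using xpos by (intro member_le_sum) (auto intro: less_imp_le)
        moreover have "\<bar>x (k t) - t\<bar> \<le> D" "B + D + 1 \<le> t" using k[of t] t by auto
        ultimately show False by linarith
      qed
    qed
  qed
  then have L: "((\<lambda>t. x (k t) / h (x (k t))) \<longlongrightarrow> L) at_top"
    by (rule filterlim_compose[OF lim])
  have htop: "filterlim h at_top at_top" by (rule quasi_isometry_at_top[OF h])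
  have ge: "\<forall>\<^sub>F t in at_top. t \<ge> max T\<^sub>0 1" by (rule eventually_ge_at_top)
  have a: "((\<lambda>t. (t - x (k t)) / h t) \<longlongrightarrow> 0) at_top"
    using ge by (intro bounded_over_at_top[OF htop, of _ D])
      (elim eventually_mono, use k in \<open>force simp: abs_minus_commute\<close>)
  have b: "((\<lambda>t. (h (x (k t)) - h t) / h t) \<longlongrightarrow> 0) at_top"
  proof (rule bounded_over_at_top[OF htop, of _ "\<mu> * D + \<delta>"])
    show "\<forall>\<^sub>F t in at_top. \<bar>h (x (k t)) - h t\<bar> \<le> \<mu> * D + \<delta>"
      using ge
    proof eventually_elim
      case (elim t)
      have "\<mu> * \<bar>x (k t) - t\<bar> \<le> \<mu> * D" using k[of t] elim q(1) by (intro mult_left_mono) auto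
      then show ?case using q(3)[OF xpos[of "k t"], of t] elim by linarith
    qed
  qed
  have "((\<lambda>t. (t - x (k t)) / h t + x (k t) / h (x (k t)) * (1 + (h (x (k t)) - h t) / h t))
          \<longlongrightarrow> 0 + L * (1 + 0)) at_top"
    by (intro tendsto_intros a b L)
  then have "((\<lambda>t. (t - x (k t)) / h t + x (k t) / h (x (k t)) * (1 + (h (x (k t)) - h t) / h t))
          \<longlongrightarrow> L) at_top" by simp
  then show ?thesis
  proof (rule Lim_transform_eventually)
    show "\<forall>\<^sub>F t in at_top.
      (t - x (k t)) / h t + x (k t) / h (x (k t)) * (1 + (h (x (k t)) - h t) / h t) = t / h t"
      using ge
    proof eventually_elim
      case (elim t)
      have "h t > 0" "h (x (k t)) > 0" using q(2) xpos elim by auto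
      then show ?case by (simp add: field_simps)
    qed
  qed
qed

lemma coarsely_dense_Suc: "coarsely_dense_at_infinity (\<lambda>n. real (Suc n))"
proof -
  have "filterlim (\<lambda>n. real (Suc n)) at_top sequentially"
    using filterlim_real_sequentially filterlim_sequentially_Suc by blast
  moreover have "\<exists>n. \<bar>real (Suc n) - t\<bar> \<le> 1" if "t \<ge> 1" for t :: real
  proof (intro exI[of _ "nat \<lfloor>t\<rfloor> - 1"])
    have "real (Suc (nat \<lfloor>t\<rfloor> - 1)) = of_int \<lfloor>t\<rfloor>" using that by simp
    then show "\<bar>real (Suc (nat \<lfloor>t\<rfloor> - 1)) - t\<bar> \<le> 1" by linarith
  qed
  ultimately show ?thesis
    unfolding coarsely_dense_at_infinity_def by (auto intro!: exI[of _ "1::real"])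
qed

lemma limit_exists_iff:
  assumes "quasi_isometry h"
  shows "(\<exists>x. coarsely_dense_at_infinity x \<and> (\<lambda>n. x n / h (x n)) \<longlonglongrightarrow> L) \<longleftrightarrow>
         ((\<lambda>t. t / h t) \<longlongrightarrow> L) at_top"
proof
  assume *: "((\<lambda>t. t / h t) \<longlongrightarrow> L) at_top"
  have "filterlim (\<lambda>n. real (Suc n)) at_top sequentially"
    using coarsely_dense_Suc by (simp add: coarsely_dense_at_infinity_def)
  from filterlim_compose[OF * this] coarsely_dense_Suc
  show "\<exists>x. coarsely_dense_at_infinity x \<and> (\<lambda>n. x n / h (x n)) \<longlonglongrightarrow> L" by blast
qed (use ratio_tendsto_at_top[OF assms] in blast)

lemma ratio_bounded_distance:
  assumes h: "quasi_isometry h" "quasi_isometry h'" and bd: "bounded_distance h h'"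
    and lim: "((\<lambda>t. t / h t) \<longlongrightarrow> L) at_top"
  shows "((\<lambda>t. t / h' t) \<longlongrightarrow> L) at_top"
proof -
  obtain K where K: "\<forall>t>0. \<bar>h t - h' t\<bar> \<le> K"
    using bd unfolding bounded_distance_iff by blast
  have pos: "\<And>t. t > 0 \<Longrightarrow> h t > 0" "\<And>t. t > 0 \<Longrightarrow> h' t > 0"
    using quasi_isometryE h by metis+
  have ev: "\<forall>\<^sub>F t in at_top. (t::real) > 0" by (rule eventually_gt_at_top)
  have "((\<lambda>t. (h t - h' t) / h' t) \<longlongrightarrow> 0) at_top"
    using ev by (intro bounded_over_at_top[OF quasi_isometry_at_top[OF h(2)], of _ K])
      (elim eventually_mono, use K in auto)
  from tendsto_mult[OF lim tendsto_add[OF tendsto_const[of 1] this]]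
  have "((\<lambda>t. t / h t * (1 + (h t - h' t) / h' t)) \<longlongrightarrow> L) at_top" by simp
  then show ?thesis
  proof (rule Lim_transform_eventually)
    show "\<forall>\<^sub>F t in at_top. t / h t * (1 + (h t - h' t) / h' t) = t / h' t"
      using ev
    proof eventually_elim
      case (elim t)
      then show ?case using pos[of t] by (simp add: field_simps)
    qed
  qed
qed

lemma limit_set_eq:
  assumes "quasi_isometry g" "quasi_inverse g h"
  shows "limit_set (qi_class g) = {L. ((\<lambda>t. t / h t) \<longlongrightarrow> L) at_top}"
proof -
  have qh: "quasi_isometry h" using assms(2) by (simp add: quasi_inverse_def)
  have "g \<in> qi_class g" using assms(1) by (simp add: qi_class_def qi_rel_def bounded_distance_refl)
  moreover have "((\<lambda>t. t / h t) \<longlongrightarrow> L) at_top"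
    if *: "g' \<in> qi_class g" "quasi_inverse g' h'" "((\<lambda>t. t / h' t) \<longlongrightarrow> L) at_top" for g' h' L
  proof -
    have g': "quasi_isometry g'" "bounded_distance g g'"
      using *(1) by (auto simp: qi_class_def qi_rel_def)
    have "bounded_distance h' h"
      using quasi_inverse_unique[OF assms(1) g'(1,2) assms(2) *(2)] by (rule bounded_distance_sym)
    then show ?thesis using ratio_bounded_distance *(2,3) qh by (auto simp: quasi_inverse_def)
  qed
  moreover have "L \<in> limit_set (qi_class g) \<longleftrightarrow>
      (\<exists>g'\<in>qi_class g. \<exists>h'. quasi_inverse g' h' \<and> ((\<lambda>t. t / h' t) \<longlongrightarrow> L) at_top)" for L
    unfolding limit_set_def using limit_exists_iff quasi_inverse_def by blast
  ultimately show ?thesis using assms(2) by blast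
qed

lemma limit_set_representative:
  assumes "quasi_isometry g" "quasi_inverse g h"
  shows "limit_set (qi_class g) =
    {L. \<exists>x. coarsely_dense_at_infinity x \<and> (\<lambda>n. x n / h (x n)) \<longlonglongrightarrow> L}"
  using assms limit_exists_iff by (auto simp: limit_set_eq quasi_inverse_def)

section \<open>The subgroups\<close>

lemma subgroup_dilation_centralizer:
  assumes "lam > 0"
  shows "subgroup (dilation_centralizer lam) QI"
proof -
  interpret group QI by (rule group_QI)
  define d where "d = qi_class (dilation lam)"
  have d: "d \<in> carrier QI" using quasi_isometry_dilation[OF assms] by (simp add: d_def carrier_QI)
  have C: "dilation_centralizer lam = {q \<in> carrier QI. q \<otimes>\<^bsub>QI\<^esub> d = d \<otimes>\<^bsub>QI\<^esub> q}"
    by (simp add: dilation_centralizer_def d_def)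
  show ?thesis
  proof (rule subgroupI)
    show "dilation_centralizer lam \<noteq> {}" using d by (auto simp: C)
  next
    fix a assume "a \<in> dilation_centralizer lam"
    then have a: "a \<in> carrier QI" "a \<otimes>\<^bsub>QI\<^esub> d = d \<otimes>\<^bsub>QI\<^esub> a" by (auto simp: C)
    have "inv\<^bsub>QI\<^esub> a \<otimes>\<^bsub>QI\<^esub> d = inv\<^bsub>QI\<^esub> a \<otimes>\<^bsub>QI\<^esub> (d \<otimes>\<^bsub>QI\<^esub> a) \<otimes>\<^bsub>QI\<^esub> inv\<^bsub>QI\<^esub> a"
      using a d by (simp add: m_assoc)
    also have "\<dots> = d \<otimes>\<^bsub>QI\<^esub> inv\<^bsub>QI\<^esub> a" using a d by (simp flip: a(2) m_assoc)
    finally show "inv\<^bsub>QI\<^esub> a \<in> dilation_centralizer lam" using a by (simp add: C)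
  next
    fix a b assume "a \<in> dilation_centralizer lam" "b \<in> dilation_centralizer lam"
    then have a: "a \<in> carrier QI" "a \<otimes>\<^bsub>QI\<^esub> d = d \<otimes>\<^bsub>QI\<^esub> a"
      and b: "b \<in> carrier QI" "b \<otimes>\<^bsub>QI\<^esub> d = d \<otimes>\<^bsub>QI\<^esub> b" by (auto simp: C)
    have "a \<otimes>\<^bsub>QI\<^esub> b \<otimes>\<^bsub>QI\<^esub> d = a \<otimes>\<^bsub>QI\<^esub> d \<otimes>\<^bsub>QI\<^esub> b" using a(1) b d by (simp add: m_assoc)
    also have "\<dots> = d \<otimes>\<^bsub>QI\<^esub> (a \<otimes>\<^bsub>QI\<^esub> b)" using a b(1) d by (simp add: m_assoc)
    finally show "a \<otimes>\<^bsub>QI\<^esub> b \<in> dilation_centralizer lam" using a b by (simp add: C)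
  qed (auto simp: C)
qed

lemma limit_set_id: "limit_set (qi_class id) \<noteq> {}"
proof -
  have "quasi_inverse id id"
    by (simp add: quasi_inverse_def quasi_isometry_id bounded_distance_refl)
  moreover have "((\<lambda>t. t / id t) \<longlongrightarrow> (1::real)) at_top"
    by (rule tendsto_eventually, rule eventually_mono[OF eventually_gt_at_top[of 0]]) simp
  ultimately show ?thesis using limit_set_eq[OF quasi_isometry_id] by blast
qed

lemma limit_set_mult:
  assumes "quasi_isometry f" "quasi_isometry g"
    "limit_set (qi_class f) \<noteq> {}" "limit_set (qi_class g) \<noteq> {}"
  shows "limit_set (qi_class (f \<circ> g)) \<noteq> {}"
proof -
  obtain f' g' where inv: "quasi_inverse f f'" "quasi_inverse g g'"
    using quasi_inverse_exists assms(1,2) by blast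
  then have q: "quasi_isometry f'" by (simp add: quasi_inverse_def)
  obtain K L where K: "((\<lambda>t. t / f' t) \<longlongrightarrow> K) at_top" and L: "((\<lambda>t. t / g' t) \<longlongrightarrow> L) at_top"
    using assms limit_set_eq inv by blast
  have "((\<lambda>t. t / f' t * (f' t / g' (f' t))) \<longlongrightarrow> K * L) at_top"
    by (intro tendsto_mult K filterlim_compose[OF L quasi_isometry_at_top[OF q]])
  then have "((\<lambda>t. t / (g' \<circ> f') t) \<longlongrightarrow> K * L) at_top"
  proof (rule Lim_transform_eventually)
    have "f' t > 0" if "t > 0" for t using quasi_isometryE q that by metis
    then show "\<forall>\<^sub>F t in at_top. t / f' t * (f' t / g' (f' t)) = t / (g' \<circ> f') t"
      by (intro eventually_mono[OF eventually_gt_at_top[of 0]]) force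
  qed
  then show ?thesis
    using limit_set_eq[OF quasi_isometry_comp quasi_inverse_comp] assms inv by blast
qed

lemma limit_set_inv:
  assumes g: "quasi_isometry g" and h: "quasi_inverse g h"
    and ne: "limit_set (qi_class g) \<noteq> {}"
  shows "limit_set (qi_class h) \<noteq> {}"
proof -
  have qh: "quasi_isometry h" "bounded_distance (h \<circ> g) id"
    using h by (auto simp: quasi_inverse_def)
  obtain L where L: "((\<lambda>t. t / h t) \<longlongrightarrow> L) at_top" using ne limit_set_eq[OF g h] by blast
  obtain \<mu> \<delta> M where q: "\<mu> \<ge> 1" "\<And>x. x > 0 \<Longrightarrow> h x > 0"
    "\<And>x y. x > 0 \<Longrightarrow> y > 0 \<Longrightarrow> \<bar>h x - h y\<bar> \<le> \<mu> * \<bar>x - y\<bar> + \<delta>"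
    using quasi_isometryE[OF qh(1)] by metis
  have "L \<ge> 1 / (\<mu> + 1)"
  proof (rule tendsto_lowerbound[OF L])
    show "\<forall>\<^sub>F t in at_top. 1 / (\<mu> + 1) \<le> t / h t"
    proof (rule eventually_at_top_linorderI[of "1 + h 1 + \<bar>\<delta>\<bar>"])
      fix t assume t: "1 + h 1 + \<bar>\<delta>\<bar> \<le> t"
      then have t1: "t \<ge> 1" using q(2)[of 1] by simp
      then have "\<bar>h t - h 1\<bar> \<le> \<mu> * (t - 1) + \<delta>" using q(3)[of t 1] by simp
      then have "h t \<le> (\<mu> + 1) * t" using t q(1) by (simp add: algebra_simps)
      then show "1 / (\<mu> + 1) \<le> t / h t" using q(1) q(2)[of t] t1 by (simp add: field_simps)
    qed
  qed simp
  moreover have "1 / (\<mu> + 1) > 0" using q(1) by simp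
  ultimately have L0: "L \<noteq> 0" by linarith
  have gL: "((\<lambda>t. g t / h (g t)) \<longlongrightarrow> L) at_top"
    by (rule filterlim_compose[OF L quasi_isometry_at_top[OF g]])
  have pos: "g t > 0" if "t > 0" for t using quasi_isometryE g that by metis
  obtain K where K: "\<forall>t>0. \<bar>h (g t) - t\<bar> \<le> K"
    using qh(2) unfolding bounded_distance_iff by auto
  have gt: "filterlim g at_top at_top" by (rule quasi_isometry_at_top[OF g])
  have "((\<lambda>t. (t - h (g t)) / g t) \<longlongrightarrow> 0) at_top"
    by (intro bounded_over_at_top[OF gt, of _ K] eventually_mono[OF eventually_gt_at_top[of 0]])
      (use K in \<open>auto simp: abs_minus_commute\<close>)
  from tendsto_add[OF this tendsto_inverse[OF gL L0]]
  have "((\<lambda>t. (t - h (g t)) / g t + inverse (g t / h (g t))) \<longlongrightarrow> inverse L) at_top" by simp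
  then have "((\<lambda>t. t / g t) \<longlongrightarrow> inverse L) at_top"
    by (rule Lim_transform_eventually)
      (intro eventually_mono[OF eventually_gt_at_top[of 0]], use pos in \<open>force simp: field_simps\<close>)
  then show ?thesis using limit_set_eq[OF qh(1) quasi_inverse_sym[OF g h]] by blast
qed

lemma subgroup_Cstar:
  assumes "lam > 0"
  shows "subgroup (Cstar lam) QI"
proof -
  interpret group QI by (rule group_QI)
  interpret C: subgroup "dilation_centralizer lam" QI
    by (rule subgroup_dilation_centralizer[OF assms])
  show ?thesis
  proof (rule subgroupI)
    show "Cstar lam \<noteq> {}" using C.one_closed limit_set_id by (auto simp: Cstar_def one_QI)
  next
    fix a assume a: "a \<in> Cstar lam"
    then have "a \<in> carrier QI" using C.subset by (auto simp: Cstar_def)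
    then obtain g h where "quasi_isometry g" "a = qi_class g" "quasi_inverse g h"
      using quasi_inverse_exists unfolding carrier_QI by blast
    then show "inv\<^bsub>QI\<^esub> a \<in> Cstar lam"
      using a C.m_inv_closed[of a] limit_set_inv[of g h] by (simp add: Cstar_def inv_QI)
  next
    fix a b assume a: "a \<in> Cstar lam" and b: "b \<in> Cstar lam"
    then have "a \<in> carrier QI" "b \<in> carrier QI" using C.subset by (auto simp: Cstar_def)
    then obtain f g where "quasi_isometry f" "a = qi_class f" "quasi_isometry g" "b = qi_class g"
      by (auto simp: carrier_QI)
    then show "a \<otimes>\<^bsub>QI\<^esub> b \<in> Cstar lam"
      using a b C.m_closed[of a b] limit_set_mult by (auto simp: Cstar_def mult_QI)
  qed (use C.subset in \<open>auto simp: Cstar_def\<close>)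
qed

lemma group_Cstar_group: "lam > 0 \<Longrightarrow> group (Cstar_group lam)"
  unfolding Cstar_group_def
  by (rule subgroup.subgroup_is_group[OF subgroup_Cstar group_QI])

lemma group_pos_real_group: "group pos_real_group"
proof (rule groupI)
  fix x assume "x \<in> carrier pos_real_group"
  then show "\<exists>y\<in>carrier pos_real_group. y \<otimes>\<^bsub>pos_real_group\<^esub> x = \<one>\<^bsub>pos_real_group\<^esub>"
    by (intro bexI[of _ "inverse x"]) (auto simp: pos_real_group_def)
qed (auto simp: pos_real_group_def)

end

theory Submission
  imports Defs
begin

text \<open>
  The isomorphism is \<open>c \<mapsto> [x \<mapsto> c x]\<close>.  Dilations compose by multiplying their factors, commute
  with one another, have the limit set \<open>{c}\<close>, and two of them are at bounded distance only if
  their factors agree, so this is an injective homomorphism from the positive reals into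
  \<open>C*([f\<^sub>\<lambda>])\<close>.

  The content is surjectivity.  If \<open>[g]\<close> commutes with \<open>[f\<^sub>\<lambda>]\<close>, then \<open>g (\<lambda> x)\<close> differs from
  \<open>\<lambda> g x\<close> by at most a constant \<open>K\<close>.  As in Hyers' stability argument for almost linear maps,
  iterating this and dividing by \<open>\<lambda>\<^sup>n\<close> produces errors that form a geometric series:
  \<open>\<bar>g (\<lambda>\<^sup>n x) / \<lambda>\<^sup>n - g x\<bar> \<le> K / (\<lambda> - 1)\<close> for all \<open>n\<close>
  (\<open>almost_homogeneous_power\<close>).  A nonempty limit set means (\<open>slope_of_limit_set\<close>)
  that \<open>g y / y\<close> converges to some \<open>L\<close> as \<open>y\<close> tends to infinity, hence
  \<open>g (\<lambda>\<^sup>n x) / \<lambda>\<^sup>n\<close> tends to \<open>L x\<close>, and the bound passes to the limit: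
  \<open>g\<close> is within \<open>K / (\<lambda> - 1)\<close> of \<open>x \<mapsto> L x\<close>
  (\<open>almost_homogeneous_near_linear\<close>).  Finally \<open>L\<close> is positive, as otherwise \<open>g\<close> would
  be bounded above.
\<close>

lemma dilation_comp: "dilation a \<circ> dilation b = dilation (a * b)"
  by (auto simp: dilation_def)

lemma bounded_distance_dilation_iff:
  "bounded_distance (dilation a) (dilation b) \<longleftrightarrow> a = b"
proof
  assume "bounded_distance (dilation a) (dilation b)"
  then obtain K where K: "K \<ge> 0" "\<And>x. x > 0 \<Longrightarrow> \<bar>a * x - b * x\<bar> \<le> K"
    unfolding bounded_distance_iff dilation_def by blast
  show "a = b"
  proof (rule ccontr)
    assume "a \<noteq> b"
    then have pos: "\<bar>a - b\<bar> > 0" by simp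
    define x where "x = (K + 1) / \<bar>a - b\<bar>"
    have x: "x > 0" "\<bar>a - b\<bar> * x = K + 1" using K(1) pos by (simp_all add: x_def)
    have "\<bar>a * x - b * x\<bar> = \<bar>a - b\<bar> * x" using x(1) by (simp add: abs_mult flip: left_diff_distrib)
    then show False using K(2)[OF x(1)] x(2) by simp
  qed
qed (simp add: bounded_distance_refl)

lemma quasi_inverse_dilation:
  assumes "c > 0"
  shows "quasi_inverse (dilation c) (dilation (inverse c))"
  using assms quasi_isometry_dilation[of "inverse c"]
  by (simp add: quasi_inverse_def dilation_comp dilation_1 bounded_distance_refl)

lemma limit_set_dilation:
  assumes "c > 0"
  shows "limit_set (qi_class (dilation c)) = {c}"
proof -
  have lim: "((\<lambda>t. t / dilation (inverse c) t) \<longlongrightarrow> c) at_top"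
    using assms
    by (intro tendsto_eventually eventually_mono[OF eventually_gt_at_top[of 0]])
      (simp add: dilation_def field_simps)
  have "L = c" if "((\<lambda>t. t / dilation (inverse c) t) \<longlongrightarrow> L) at_top" for L
    by (rule tendsto_unique[OF _ that lim]) simp
  with lim show ?thesis
    using limit_set_eq[OF quasi_isometry_dilation quasi_inverse_dilation] assms by blast
qed

lemma dilation_in_Cstar:
  assumes "lam > 0" "c > 0"
  shows "qi_class (dilation c) \<in> Cstar lam"
  using assms
  by (simp add: Cstar_def dilation_centralizer_def carrier_QI quasi_isometry_dilation mult_QI
      dilation_comp mult.commute limit_set_dilation)

text \<open>
  The limit set is defined through a quasi-inverse \<open>h\<close> evaluated at \<open>t\<close>.  Substituting \<open>t = g y\<close>
  turns the quotient \<open>t / h t\<close> into \<open>g y / (y + O(1))\<close>.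
\<close>

lemma slope_of_limit_set:
  assumes g: "quasi_isometry g" and L: "L \<in> limit_set (qi_class g)"
  shows "((\<lambda>y. g y / y) \<longlongrightarrow> L) at_top"
proof -
  obtain h where h: "quasi_inverse g h" using quasi_inverse_exists[OF g] by blast
  then have qh: "quasi_isometry h" by (simp add: quasi_inverse_def)
  have gtop: "filterlim g at_top at_top" by (rule quasi_isometry_at_top[OF g])
  have pos: "g y > 0" "h y > 0" if "y > 0" for y
    using quasi_isometryE g qh that by metis+
  obtain K where K: "\<forall>y>0. \<bar>h (g y) - y\<bar> \<le> K"
    using h unfolding quasi_inverse_def bounded_distance_iff by auto
  have "((\<lambda>t. t / h t) \<longlongrightarrow> L) at_top" using L limit_set_eq[OF g h] by blast
  then have 1: "((\<lambda>y. g y / h (g y)) \<longlongrightarrow> L) at_top" by (rule filterlim_compose[OF _ gtop])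
  have 2: "((\<lambda>y. (h (g y) - y) / y) \<longlongrightarrow> 0) at_top"
    by (intro bounded_over_at_top[OF filterlim_ident, of _ K]
        eventually_mono[OF eventually_gt_at_top[of 0]]) (use K in auto)
  have "((\<lambda>y. g y / h (g y) * (1 + (h (g y) - y) / y)) \<longlongrightarrow> L * (1 + 0)) at_top"
    by (intro tendsto_intros 1 2)
  then have "((\<lambda>y. g y / h (g y) * (1 + (h (g y) - y) / y)) \<longlongrightarrow> L) at_top" by simp
  then show ?thesis
  proof (rule Lim_transform_eventually)
    show "\<forall>\<^sub>F y in at_top. g y / h (g y) * (1 + (h (g y) - y) / y) = g y / y"
      using eventually_gt_at_top[of 0]
    proof eventually_elim
      case (elim y)
      then show ?case using pos(1)[of y] pos(2)[of "g y"] by (simp add: field_simps)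
    qed
  qed
qed

text \<open>
  The error made by replacing \<open>g (\<lambda>\<^sup>n x)\<close> by \<open>\<lambda>\<^sup>n g x\<close> satisfies \<open>e\<^sub>n\<^sub>+\<^sub>1 \<le> K + \<lambda> e\<^sub>n\<close>,
  whence the geometric sum.  The subtracted \<open>1\<close> in the bound is what makes the induction close.
\<close>

lemma almost_homogeneous_power:
  fixes g :: "real \<Rightarrow> real"
  assumes lam: "lam > 1" and K: "\<And>x. x > 0 \<Longrightarrow> \<bar>g (lam * x) - lam * g x\<bar> \<le> K"
    and x: "x > 0"
  shows "\<bar>g (lam ^ n * x) - lam ^ n * g x\<bar> \<le> K / (lam - 1) * (lam ^ n - 1)"
proof (induction n)
  case (Suc n)
  let ?a = "g (lam ^ n * x) - lam ^ n * g x"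
  have "lam * \<bar>?a\<bar> \<le> lam * (K / (lam - 1) * (lam ^ n - 1))"
    using Suc lam by (intro mult_left_mono) auto
  moreover have "\<bar>lam * ?a\<bar> = lam * \<bar>?a\<bar>" using lam by (simp add: abs_mult)
  moreover have "\<bar>g (lam * (lam ^ n * x)) - lam * g (lam ^ n * x)\<bar> \<le> K"
    using lam x by (intro K) simp
  moreover have "g (lam ^ Suc n * x) - lam ^ Suc n * g x =
      (g (lam * (lam ^ n * x)) - lam * g (lam ^ n * x)) + lam * ?a"
    by (simp add: algebra_simps)
  moreover have "K + lam * (K / (lam - 1) * (lam ^ n - 1)) = K / (lam - 1) * (lam ^ Suc n - 1)"
    using lam by (simp add: field_simps)
  ultimately show ?case by linarith
qed simp

text \<open>
  After division by \<open>\<lambda>\<^sup>n\<close> the preceding bound no longer depends on \<open>n\<close>, so it survives the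
  limit, in which \<open>g (\<lambda>\<^sup>n x) / \<lambda>\<^sup>n\<close> becomes \<open>L x\<close>.
\<close>

lemma almost_homogeneous_near_linear:
  fixes g :: "real \<Rightarrow> real"
  assumes lam: "lam > 1" and K: "\<And>x. x > 0 \<Longrightarrow> \<bar>g (lam * x) - lam * g x\<bar> \<le> K"
    and slope: "((\<lambda>y. g y / y) \<longlongrightarrow> L) at_top" and x: "x > 0"
  shows "\<bar>g x - L * x\<bar> \<le> K / (lam - 1)"
proof -
  have K0: "K \<ge> 0" using K[of 1] by linarith
  have "filterlim (\<lambda>n. lam ^ n) at_top sequentially"
    using lam by (intro filterlim_at_infinity_imp_filterlim_at_top
        filterlim_realpow_sequentially_gt1) auto
  then have "filterlim (\<lambda>n. x * lam ^ n) at_top sequentially"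
    by (rule filterlim_tendsto_pos_mult_at_top[OF tendsto_const x])
  then have "(\<lambda>n. g (x * lam ^ n) / (x * lam ^ n)) \<longlonglongrightarrow> L"
    by (rule filterlim_compose[OF slope])
  then have "(\<lambda>n. \<bar>g x - g (x * lam ^ n) / (x * lam ^ n) * x\<bar>) \<longlonglongrightarrow> \<bar>g x - L * x\<bar>"
    by (intro tendsto_intros)
  moreover have "\<bar>g x - g (x * lam ^ n) / (x * lam ^ n) * x\<bar> \<le> K / (lam - 1)" for n
  proof -
    have p: "lam ^ n > 0" using lam by simp
    have "g x - g (x * lam ^ n) / (x * lam ^ n) * x
        = - ((g (lam ^ n * x) - lam ^ n * g x) / lam ^ n)"
      using lam x by (simp add: field_simps)
    then have "\<bar>g x - g (x * lam ^ n) / (x * lam ^ n) * x\<bar>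
        = \<bar>(g (lam ^ n * x) - lam ^ n * g x) / lam ^ n\<bar>"
      by (simp only: abs_minus_cancel)
    also have "\<dots> = \<bar>g (lam ^ n * x) - lam ^ n * g x\<bar> / lam ^ n" using p by simp
    also have "\<dots> \<le> (K / (lam - 1) * lam ^ n) / lam ^ n"
    proof (rule divide_right_mono)
      have "K / (lam - 1) * (lam ^ n - 1) \<le> K / (lam - 1) * lam ^ n"
        using K0 lam by (intro mult_left_mono) auto
      then show "\<bar>g (lam ^ n * x) - lam ^ n * g x\<bar> \<le> K / (lam - 1) * lam ^ n"
        using almost_homogeneous_power[where g = g and K = K, OF lam K x, of n] by linarith
    qed (use p in simp)
    also have "\<dots> = K / (lam - 1)" using lam by simp
    finally show ?thesis .
  qed
  ultimately show ?thesis by (intro LIMSEQ_le_const2) auto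
qed

lemma quasi_isometry_near_linear_slope_pos:
  assumes g: "quasi_isometry g" and bd: "bounded_distance g (dilation L)"
  shows "L > 0"
proof (rule ccontr)
  assume "\<not> L > 0"
  obtain K where K: "\<And>x. x > 0 \<Longrightarrow> \<bar>g x - L * x\<bar> \<le> K"
    using bd unfolding bounded_distance_iff dilation_def by blast
  have "\<forall>\<^sub>F x in at_top. g x > K"
    using quasi_isometry_at_top[OF g] by (simp add: filterlim_at_top_dense)
  then have "\<forall>\<^sub>F x in at_top. g x > K \<and> x > 0"
    using eventually_gt_at_top by (rule eventually_conj)
  then obtain x where x: "g x > K" "x > 0"
    using eventually_happens' trivial_limit_at_top_linorder by blast
  have "L * x \<le> 0" using \<open>\<not> L > 0\<close> x(2) by (simp add: mult_nonpos_nonneg)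
  then show False using K[OF x(2)] x(1) by linarith
qed

lemma Cstar_eq_dilations:
  assumes lam: "lam > 1"
  shows "Cstar lam = (\<lambda>c. qi_class (dilation c)) ` {0<..}"
proof
  show "(\<lambda>c. qi_class (dilation c)) ` {0<..} \<subseteq> Cstar lam"
    using dilation_in_Cstar lam by auto
  show "Cstar lam \<subseteq> (\<lambda>c. qi_class (dilation c)) ` {0<..}"
  proof
    fix q assume q: "q \<in> Cstar lam"
    then obtain g where g: "quasi_isometry g" and qg: "q = qi_class g"
      by (auto simp: Cstar_def dilation_centralizer_def carrier_QI)
    have d: "quasi_isometry (dilation lam)" using lam by (simp add: quasi_isometry_dilation)
    have "bounded_distance (g \<circ> dilation lam) (dilation lam \<circ> g)"
      using q g d
      by (simp add: Cstar_def dilation_centralizer_def qg mult_QI qi_class_eq_iff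
          quasi_isometry_comp)
    then obtain K where K: "K \<ge> 0" "\<And>x. x > 0 \<Longrightarrow> \<bar>g (lam * x) - lam * g x\<bar> \<le> K"
      unfolding bounded_distance_iff by (auto simp: dilation_def)
    obtain L where "L \<in> limit_set (qi_class g)" using q by (auto simp: Cstar_def qg)
    then have slope: "((\<lambda>y. g y / y) \<longlongrightarrow> L) at_top" by (rule slope_of_limit_set[OF g])
    have "\<bar>g x - dilation L x\<bar> \<le> K / (lam - 1)" if "x > 0" for x
      using almost_homogeneous_near_linear[where g = g and K = K, OF lam K(2) slope that]
      by (simp add: dilation_def)
    moreover have "K / (lam - 1) \<ge> 0" using K(1) lam by simp
    ultimately have bd: "bounded_distance g (dilation L)"
      unfolding bounded_distance_iff by blast
    then have L: "L > 0" by (rule quasi_isometry_near_linear_slope_pos[OF g])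
    then have "q = qi_class (dilation L)"
      using bd g by (simp add: qg qi_class_eq_iff quasi_isometry_dilation)
    with L show "q \<in> (\<lambda>c. qi_class (dilation c)) ` {0<..}" by simp
  qed
qed

theorem theorem1p1:
  fixes lam :: real
  assumes "lam > 1"
  shows "Cstar_group lam \<cong> pos_real_group"
proof -
  have "(\<lambda>c. qi_class (dilation c)) \<in> iso pos_real_group (Cstar_group lam)"
  proof (rule isoI)
    show "(\<lambda>c. qi_class (dilation c)) \<in> hom pos_real_group (Cstar_group lam)"
      using assms
      by (intro homI)
        (auto simp: pos_real_group_def Cstar_group_def dilation_in_Cstar mult_QI
          quasi_isometry_dilation dilation_comp)
    have "inj_on (\<lambda>c. qi_class (dilation c)) {0<..}"
      by (rule inj_onI)
        (simp add: qi_class_eq_iff quasi_isometry_dilation bounded_distance_dilation_iff)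
    then show "bij_betw (\<lambda>c. qi_class (dilation c))
        (carrier pos_real_group) (carrier (Cstar_group lam))"
      by (simp add: bij_betw_def pos_real_group_def Cstar_group_def Cstar_eq_dilations[OF assms])
  qed
  then have "pos_real_group \<cong> Cstar_group lam" by (rule is_isoI)
  then show ?thesis by (rule group.iso_sym[OF group_pos_real_group])
qed

end
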